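(* Let $\mathbb X=\langle X,\rho\rangle$ be a countable ultrahomogeneous relational structure whose age has the strong amalgamation property. Then: (a) $X$ can be partitioned into countably many sets $B_j$, $j\in\omega$, each of which is a large copy of $\mathbb X$; (b) there is a family $\{A_\alpha:\alpha<2^{\aleph_0}\}$ of pairwise distinct large copies of $\mathbb X$ which is almost disjoint, i.e. $A_\alpha\cap A_\beta$ is finite for all $\alpha\neq\beta$; (c) there are antichains, and indeed maximal antichains, of size $2^{\aleph_0}$ in the poset $\langle \mathbb P(\mathbb X),\subset\rangle$.
   Context: A structure $\mathbb X$ is ultrahomogeneous iff every isomorphism between finite substructures of $\mathbb X$ extends to an automorphism of $\mathbb X$. The age of $\mathbb X$ is the class of finite structures embeddable in $\mathbb X$; it has the strong amalgamation property iff for all $\mathbb A,\mathbb B,\mathbb C$ in the age and embeddings $f_0:\mathbb A\hookrightarrow\mathbb B$, $g_0:\mathbb A\hookrightarrow\mathbb C$ there are $\mathbb D$ in the age and embeddings $f_1:\mathbb B\hookrightarrow\mathbb D$, $g_1:\mathbb C\hookrightarrow\mathbb D$ with $f_1\circ f_0=g_1\circ g_0$ and $f_1[B]\cap g_1[C]=f_1[f_0[A]]$. $\mathbb P(\mathbb X)=\{f[X]: f \text{ a self-embedding of } \mathbb X\}$ is the set of (domains of) copies of $\mathbb X$, i.e. subsets $A\subseteq X$ with $\langle A,\rho\restriction A\rangle\cong\mathbb X$. For finite $F\subseteq X$ and $x\in X\setminus F$, the orbit $\mathrm{orb}_F(x)$ is the set of $y\in X\setminus F$ such that some automorphism $g$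 of $\mathbb X$ fixes $F$ pointwise and satisfies $g(x)=y$; these sets are the orbits of $\mathbb X$. A copy $A\in\mathbb P(\mathbb X)$ is large iff $A\cap O$ is infinite for every orbit $O$ of $\mathbb X$. In a poset, two elements are compatible iff they have a common lower bound in the poset, and an antichain is a set of pairwise incompatible elements; it is maximal iff every element of the poset is compatible with some member of it. *)

theory Defs
  imports Main "HOL-Library.Countable_Set" "HOL-Library.Disjoint_Sets" "HOL-Library.Equipollence"
begin

section \<open>Relational structures\<close>

text \<open>
  A relational language is a type \<open>'i\<close> of relation symbols together with an arity function
  \<open>'i \<Rightarrow> nat\<close>; it may have arbitrarily many symbols.  An \<open>n\<close>-ary relation is a set of lists of
  length \<open>n\<close>.
\<close>

record ('a, 'i) rel_struct =
  univ :: "'a set"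
  rel :: "'i \<Rightarrow> 'a list set"

definition is_struct :: "('i \<Rightarrow> nat) \<Rightarrow> ('a, 'i) rel_struct \<Rightarrow> bool" where
  "is_struct ar S \<longleftrightarrow> (\<forall>i. \<forall>xs \<in> rel S i. length xs = ar i \<and> set xs \<subseteq> univ S)"

definition substruct :: "('a, 'i) rel_struct \<Rightarrow> 'a set \<Rightarrow> ('a, 'i) rel_struct" where
  "substruct S A = \<lparr>univ = A, rel = (\<lambda>i. rel S i \<inter> lists A)\<rparr>"

text \<open>Maps between structures are only relevant on the universe of their source.\<close>

definition embedding ::
    "('a, 'i) rel_struct \<Rightarrow> ('b, 'i) rel_struct \<Rightarrow> ('a \<Rightarrow> 'b) \<Rightarrow> bool" where
  "embedding S T f \<longleftrightarrow>
     inj_on f (univ S) \<and> f ` univ S \<subseteq> univ T \<and>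
     (\<forall>i. \<forall>xs \<in> lists (univ S). xs \<in> rel S i \<longleftrightarrow> map f xs \<in> rel T i)"

definition isomorphism ::
    "('a, 'i) rel_struct \<Rightarrow> ('b, 'i) rel_struct \<Rightarrow> ('a \<Rightarrow> 'b) \<Rightarrow> bool" where
  "isomorphism S T f \<longleftrightarrow> embedding S T f \<and> f ` univ S = univ T"

abbreviation automorphism :: "('a, 'i) rel_struct \<Rightarrow> ('a \<Rightarrow> 'a) \<Rightarrow> bool" where
  "automorphism S \<equiv> isomorphism S S"

definition ultrahomogeneous :: "('a, 'i) rel_struct \<Rightarrow> bool" where
  "ultrahomogeneous S \<longleftrightarrow>
     (\<forall>F G p. finite F \<and> F \<subseteq> univ S \<and> finite G \<and> G \<subseteq> univ S \<and>
        isomorphism (substruct S F) (substruct S G) p \<longrightarrow>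
        (\<exists>g. automorphism S g \<and> (\<forall>x\<in>F. g x = p x)))"

text \<open>
  The age is a proper class; here it is represented by its members whose universe is a set of
  elements of \<open>'a\<close>.  Nothing is lost up to isomorphism, as every structure embeddable in \<open>S\<close>
  is isomorphic to a substructure of \<open>S\<close>.  The empty structure belongs to the age.
\<close>

definition age :: "('i \<Rightarrow> nat) \<Rightarrow> ('a, 'i) rel_struct \<Rightarrow> ('a, 'i) rel_struct set" where
  "age ar S = {A. is_struct ar A \<and> finite (univ A) \<and> (\<exists>f. embedding A S f)}"

definition strong_amalgamation :: "('a, 'i) rel_struct set \<Rightarrow> bool" where
  "strong_amalgamation K \<longleftrightarrow>
     (\<forall>A\<in>K. \<forall>B\<in>K. \<forall>C\<in>K. \<forall>f0 g0. embedding A B f0 \<and> embedding A C g0 \<longrightarrow>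
        (\<exists>D\<in>K. \<exists>f1 g1. embedding B D f1 \<and> embedding C D g1 \<and>
           (\<forall>a\<in>univ A. f1 (f0 a) = g1 (g0 a)) \<and>
           f1 ` univ B \<inter> g1 ` univ C = f1 ` f0 ` univ A))"

definition copies :: "('a, 'i) rel_struct \<Rightarrow> 'a set set" where
  "copies S = {f ` univ S | f. embedding S S f}"

definition orb :: "('a, 'i) rel_struct \<Rightarrow> 'a set \<Rightarrow> 'a \<Rightarrow> 'a set" where
  "orb S F x =
     {y \<in> univ S - F. \<exists>g. automorphism S g \<and> (\<forall>z\<in>F. g z = z) \<and> g x = y}"

definition orbits :: "('a, 'i) rel_struct \<Rightarrow> 'a set set" where
  "orbits S = {orb S F x | F x. finite F \<and> F \<subseteq> univ S \<and> x \<in> univ S - F}"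

definition large_copies :: "('a, 'i) rel_struct \<Rightarrow> 'a set set" where
  "large_copies S = {A \<in> copies S. \<forall>Orb \<in> orbits S. infinite (A \<inter> Orb)}"

section \<open>Antichains\<close>

text \<open>
  The poset is the set \<open>P\<close> with the order of its type; on sets this is inclusion.  Antichains
  are understood in the sense of forcing, through incompatibility rather than incomparability.
\<close>

definition compatible_in :: "'p::order set \<Rightarrow> 'p \<Rightarrow> 'p \<Rightarrow> bool" where
  "compatible_in P p q \<longleftrightarrow> (\<exists>r\<in>P. r \<le> p \<and> r \<le> q)"

definition antichain_in :: "'p::order set \<Rightarrow> 'p set \<Rightarrow> bool" where
  "antichain_in P Q \<longleftrightarrow> Q \<subseteq> P \<and> pairwise (\<lambda>p q. \<not> compatible_in P p q) Q"

definition maximal_antichain_in :: "'p::order set \<Rightarrow> 'p set \<Rightarrow> bool" where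
  "maximal_antichain_in P Q \<longleftrightarrow>
     antichain_in P Q \<and> (\<forall>p\<in>P. \<exists>q\<in>Q. compatible_in P p q)"

definition has_size_continuum :: "'p set \<Rightarrow> bool" where
  "has_size_continuum Q \<longleftrightarrow> Q \<approx> (UNIV :: nat set set)"

end

theory Submission
  imports Defs
begin

text \<open>
  Strong amalgamation makes every orbit infinite, and by back and forth a set that meets each
  orbit \<open>orb X F x\<close> with \<open>F\<close> inside the set is a copy. So a subset of \<open>univ X\<close> is a large copy
  as soon as it meets every orbit in an infinite set. There are only countably many orbits, and
  one can choose distinct points from any countable list of them, with repetitions. Listing each
  orbit infinitely often for each \<open>j\<close> gives the partition; attaching finitely many chosen points to
  each node of the binary tree and collecting them along branches gives the almost disjoint family.
  Copies are infinite, so an almost disjoint family of copies is an antichain, which Zorn's lemma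
  extends to a maximal one.
\<close>

section \<open>Embeddings and automorphisms\<close>

lemma embedding_comp:
  assumes "embedding S T f" "embedding T U g"
  shows "embedding S U (g \<circ> f)"
proof -
  have "inj_on (g \<circ> f) (univ S)"
    using assms unfolding embedding_def by (meson comp_inj_on inj_on_subset)
  moreover have "(g \<circ> f) ` univ S \<subseteq> univ U"
    using assms unfolding embedding_def by (auto simp: image_subset_iff)
  moreover have "xs \<in> rel S i \<longleftrightarrow> map (g \<circ> f) xs \<in> rel U i" if "xs \<in> lists (univ S)" for i xs
  proof -
    have "map f xs \<in> lists (univ T)"
      using that assms(1) unfolding embedding_def by (auto simp: image_subset_iff)
    with that assms show ?thesis
      unfolding embedding_def by (metis map_map)
  qed
  ultimately show ?thesis
    unfolding embedding_def by blast
qed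

lemma embedding_substruct_subset:
  assumes "A \<subseteq> B"
  shows "embedding (substruct S A) (substruct S B) id"
  using assms unfolding embedding_def substruct_def by auto

lemma embedding_substruct:
  assumes "A \<subseteq> univ S"
  shows "embedding (substruct S A) S id"
  using assms unfolding embedding_def substruct_def by auto

lemma automorphism_imp_embedding: "automorphism S g \<Longrightarrow> embedding S S g"
  by (simp add: isomorphism_def)

lemma automorphism_id: "automorphism S id"
  by (simp add: isomorphism_def embedding_def)

lemma automorphism_comp:
  assumes "automorphism S f" "automorphism S g"
  shows "automorphism S (g \<circ> f)"
  using assms embedding_comp[of S S f S g] unfolding isomorphism_def
  by (metis image_comp)

lemma automorphism_inv_into:
  assumes "automorphism S g"
  shows "automorphism S (inv_into (univ S) g)"
proof -
  have b: "bij_betw g (univ S) (univ S)"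
    using assms unfolding isomorphism_def embedding_def bij_betw_def by blast
  then have bi: "bij_betw (inv_into (univ S) g) (univ S) (univ S)"
    by (rule bij_betw_inv_into)
  have "xs \<in> rel S i \<longleftrightarrow> map (inv_into (univ S) g) xs \<in> rel S i" if xs: "xs \<in> lists (univ S)" for i xs
  proof -
    let ?ys = "map (inv_into (univ S) g) xs"
    have "?ys \<in> lists (univ S)"
      using xs bij_betwE[OF bi] by auto
    then have "?ys \<in> rel S i \<longleftrightarrow> map g ?ys \<in> rel S i"
      using assms unfolding isomorphism_def embedding_def by blast
    moreover have "map g ?ys = xs"
      using xs b by (auto intro!: map_idI simp: bij_betw_inv_into_right)
    ultimately show ?thesis by simp
  qed
  with bi show ?thesis
    unfolding isomorphism_def embedding_def bij_betw_def by blast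
qed

lemma ultrahomogeneous_extend:
  assumes "ultrahomogeneous S" "finite F" "F \<subseteq> univ S" "embedding (substruct S F) S p"
  obtains g where "automorphism S g" "\<And>x. x \<in> F \<Longrightarrow> g x = p x"
proof -
  have "isomorphism (substruct S F) (substruct S (p ` F)) p"
    using assms(4) unfolding isomorphism_def embedding_def substruct_def by auto
  moreover have "p ` F \<subseteq> univ S"
    using assms(4) unfolding embedding_def substruct_def by auto
  ultimately have "\<exists>g. automorphism S g \<and> (\<forall>x\<in>F. g x = p x)"
    using assms(1-3) unfolding ultrahomogeneous_def by (meson finite_imageI)
  then show thesis
    using that by blast
qed

lemma substruct_in_age:
  assumes "is_struct ar S" "finite F" "F \<subseteq> univ S"
  shows "substruct S F \<in> age ar S"
proof -
  have "is_struct ar (substruct S F)"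
    using assms(1) unfolding is_struct_def substruct_def by auto
  then show ?thesis
    using embedding_substruct[OF assms(3)] assms(2) unfolding age_def
    by (auto simp: substruct_def)
qed

section \<open>Orbits\<close>

text \<open>Amalgamate \<open>insert x F\<close> and \<open>G\<close> strongly over
  \<open>F\<close>: in the amalgam the image of \<open>x\<close> avoids the image of
  \<open>G\<close>. Embed the amalgam in \<open>S\<close> and use ultrahomogeneity twice, first to
  move the copy of \<open>G\<close> back onto \<open>G\<close> pointwise, then to realise the
  resulting map on \<open>insert x F\<close> by an automorphism that fixes \<open>F\<close>.\<close>

lemma orb_not_subset_finite:
  assumes S: "is_struct ar S" "ultrahomogeneous S" "strong_amalgamation (age ar S)"
    and F: "finite F" "F \<subseteq> univ S" and x: "x \<in> univ S - F"
    and G: "finite G" "F \<subseteq> G" "G \<subseteq> univ S"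
  shows "\<exists>y \<in> orb S F x. y \<notin> G"
proof -
  let ?A = "substruct S F" and ?B = "substruct S (insert x F)" and ?C = "substruct S G"
  have univs: "univ ?A = F" "univ ?B = insert x F" "univ ?C = G"
    by (simp_all add: substruct_def)
  have "?A \<in> age ar S" "?B \<in> age ar S" "?C \<in> age ar S"
    using S(1) F x G by (auto intro: substruct_in_age)
  moreover have "embedding ?A ?B id" "embedding ?A ?C id"
    using G by (auto intro: embedding_substruct_subset)
  ultimately have "\<exists>D\<in>age ar S. \<exists>f1 g1. embedding ?B D f1 \<and> embedding ?C D g1 \<and>
      (\<forall>a\<in>univ ?A. f1 (id a) = g1 (id a)) \<and> f1 ` univ ?B \<inter> g1 ` univ ?C = f1 ` id ` univ ?A"
    using S(3)[unfolded strong_amalgamation_def, rule_format, of ?A ?B ?C id id] by blast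
  then obtain D f1 g1 where D: "D \<in> age ar S"
    and f1: "embedding ?B D f1" and g1: "embedding ?C D g1"
    and eq: "\<forall>a\<in>F. f1 a = g1 a" and int: "f1 ` insert x F \<inter> g1 ` G = f1 ` F"
    unfolding univs by auto
  obtain h where h: "embedding D S h"
    using D unfolding age_def by blast
  have hinj: "inj_on h (univ D)" and fD: "f1 ` insert x F \<subseteq> univ D" and gD: "g1 ` G \<subseteq> univ D"
    and finj: "inj_on f1 (insert x F)"
    using h f1 g1 unfolding embedding_def univs by auto
  \<comment> \<open>The automorphism \<open>\<phi>\<close> carries \<open>G\<close> to its copy
    inside the embedded amalgam, so its inverse \<open>\<psi>\<close> puts that copy back in
    place.\<close>
  obtain \<phi> where \<phi>: "automorphism S \<phi>" and \<phi>G: "\<And>z. z \<in> G \<Longrightarrow> \<phi> z = (h \<circ> g1) z"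
    using ultrahomogeneous_extend[OF S(2) G(1,3) embedding_comp[OF g1 h]] by blast
  have \<phi>inj: "inj_on \<phi> (univ S)" and \<phi>surj: "\<phi> ` univ S = univ S"
    using \<phi> unfolding isomorphism_def embedding_def by auto
  define \<psi> where "\<psi> = inv_into (univ S) \<phi>"
  have \<psi>: "automorphism S \<psi>"
    unfolding \<psi>_def by (rule automorphism_inv_into[OF \<phi>])
  have "embedding ?B S (\<psi> \<circ> (h \<circ> f1))"
    by (intro embedding_comp[OF _ automorphism_imp_embedding[OF \<psi>]] embedding_comp[OF f1 h])
  moreover have "finite (insert x F)" "insert x F \<subseteq> univ S"
    using F x by auto
  ultimately obtain k where k: "automorphism S k"
    and kB: "\<And>z. z \<in> insert x F \<Longrightarrow> k z = (\<psi> \<circ> (h \<circ> f1)) z"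
    using ultrahomogeneous_extend[OF S(2)] by blast
  \<comment> \<open>The amalgam identifies the two images of \<open>F\<close>, so on
    \<open>F\<close> the map \<open>h \<circ> f1\<close> agrees with \<open>\<phi>\<close> and is
    undone by \<open>\<psi>\<close>.\<close>
  have kF: "k z = z" if "z \<in> F" for z
  proof -
    have "(h \<circ> f1) z = \<phi> z"
      using that eq G(2) \<phi>G[of z] univs by auto
    then have "k z = \<psi> (\<phi> z)"
      using kB[of z] that by simp
    then show ?thesis
      using \<phi>inj that F(2) unfolding \<psi>_def by (auto simp: inv_into_f_f)
  qed
  have kx: "k x \<in> univ S"
    using k x unfolding isomorphism_def embedding_def by auto
  have kxG: "k x \<notin> G"
  proof
    assume a: "k x \<in> G"
    have "h (f1 x) \<in> \<phi> ` univ S"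
      using h fD \<phi>surj unfolding embedding_def by auto
    then have "\<phi> (k x) = h (f1 x)"
      using kB[of x] unfolding \<psi>_def by (simp add: f_inv_into_f)
    then have "h (g1 (k x)) = h (f1 x)"
      using \<phi>G[OF a] by simp
    then have "g1 (k x) = f1 x"
      using hinj fD gD a by (meson image_subset_iff inj_onD insertI1)
    then have "f1 x \<in> f1 ` F"
      using int a by (metis IntI imageI insertI1)
    then show False
      using finj x by (auto simp: inj_on_def)
  qed
  have "k x \<in> orb S F x"
    using k kF kx kxG G(2) unfolding orb_def by auto
  with kxG show ?thesis by blast
qed

text \<open>A finite orbit could be taken, together with \<open>F\<close>, as the finite set
  \<open>G\<close> of the previous lemma, which would give a point of the orbit outside the
  orbit.\<close>

lemma infinite_orbits:
  assumes S: "is_struct ar S" "ultrahomogeneous S" "strong_amalgamation (age ar S)"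
    and Orb: "Orb \<in> orbits S"
  shows "infinite Orb"
proof
  obtain F x where F: "finite F" "F \<subseteq> univ S" "x \<in> univ S - F" and Orb_eq: "Orb = orb S F x"
    using Orb unfolding orbits_def by blast
  assume "finite Orb"
  moreover have "Orb \<subseteq> univ S"
    unfolding Orb_eq orb_def by auto
  ultimately have "\<exists>y \<in> Orb. y \<notin> F \<union> Orb"
    using orb_not_subset_finite[OF S F, of "F \<union> Orb"] F Orb_eq by auto
  then show False by blast
qed

lemma countable_orbits:
  assumes "countable (univ S)"
  shows "countable (orbits S)"
proof -
  have "orbits S \<subseteq> (\<lambda>(F, x). orb S F x) ` ({F. finite F \<and> F \<subseteq> univ S} \<times> univ S)"
    unfolding orbits_def by auto
  then show ?thesis
    using countable_Collect_finite_subset[OF assms] assms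
    by (auto intro: countable_subset simp: conj_commute)
qed

section \<open>Sets meeting the orbits are copies\<close>

text \<open>The extension step of the back and forth. The orbit of \<open>g x\<close> over
  \<open>g\<close>
  F\<open>meets\<close>A\<open>; composing\<close>g\<open>with an automorphism that fixes\<close>g
  \<open>F\<close> and sends \<open>g x\<close> into \<open>A\<close> leaves the values on
  \<open>F\<close> unchanged.\<close>

lemma extend_partial_automorphism:
  assumes g: "automorphism S g" and F: "finite F" "F \<subseteq> univ S" "g ` F \<subseteq> A" and A: "A \<subseteq> univ S"
    and meets: "\<And>F x. \<lbrakk>finite F; F \<subseteq> A; x \<in> univ S - F\<rbrakk> \<Longrightarrow> orb S F x \<inter> A \<noteq> {}"
    and x: "x \<in> univ S"
  obtains g' where "automorphism S g'" "\<And>z. z \<in> F \<Longrightarrow> g' z = g z" "g' x \<in> A"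
proof (cases "x \<in> F")
  case True
  then show ?thesis
    using that[of g] g F by auto
next
  case False
  have "inj_on g (univ S)" "g ` univ S = univ S"
    using g unfolding isomorphism_def embedding_def by auto
  then have "g x \<in> univ S - g ` F"
    using False x F(2) by (auto simp: inj_on_def subset_iff)
  then obtain k where k: "automorphism S k" "\<forall>z\<in>g ` F. k z = z" "k (g x) \<in> A"
    using meets[of "g ` F" "g x"] F unfolding orb_def by blast
  show ?thesis
  proof (rule that)
    show "automorphism S (k \<circ> g)"
      by (rule automorphism_comp[OF g k(1)])
  qed (use k in auto)
qed

text \<open>An embedding onto \<open>A\<close> is built as the union of finite restrictions of
  automorphisms. The orbit condition is needed only to keep the values in \<open>A\<close>;
  surjectivity onto \<open>A\<close> comes from the approximations being automorphisms of all of
  \<open>S\<close>.\<close>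

lemma copiesI:
  assumes cnt: "countable (univ S)" and A: "A \<subseteq> univ S"
    and meets: "\<And>F x. \<lbrakk>finite F; F \<subseteq> A; x \<in> univ S - F\<rbrakk> \<Longrightarrow> orb S F x \<inter> A \<noteq> {}"
  shows "A \<in> copies S"
proof (cases "univ S = {}")
  case True
  then have "A = id ` univ S"
    using A by auto
  then show ?thesis
    using automorphism_imp_embedding[OF automorphism_id, of S] unfolding copies_def by blast
next
  case False
  \<comment> \<open>An orbit over the empty set already has to meet \<open>A\<close>.\<close>
  then have "A \<noteq> {}"
    using meets[of "{}"] by auto
  define e where "e = from_nat_into (univ S)"
  define d where "d = from_nat_into A"
  have e: "range e = univ S" and d: "range d = A"
    unfolding e_def d_def using False \<open>A \<noteq> {}\<close> cnt countable_subset[OF A cnt]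
    by (simp_all add: range_from_nat_into)
  \<comment> \<open>A stage is a pair \<open>(F, g)\<close> of which only the restriction of
    \<open>g\<close> to the finite set \<open>F\<close> is retained. Keeping a full automorphism
    spares a further appeal to ultrahomogeneity at each stage.\<close>
  define P where "P n p \<longleftrightarrow> (case p of (F, g) \<Rightarrow>
      finite F \<and> F \<subseteq> univ S \<and> automorphism S g \<and> g ` F \<subseteq> A)"
    for n :: nat and p :: "'a set \<times> ('a \<Rightarrow> 'a)"
  \<comment> \<open>Stage \<open>n\<close> puts \<open>e n\<close> into the domain and
    \<open>d n\<close> into the range while preserving earlier values.\<close>
  define Q where "Q n p q \<longleftrightarrow> (case (p, q) of ((F, g), (F', g')) \<Rightarrow>
      F \<subseteq> F' \<and> (\<forall>z\<in>F. g' z = g z) \<and> e n \<in> F' \<and> d n \<in> g' ` F')"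
    for n :: nat and p q :: "'a set \<times> ('a \<Rightarrow> 'a)"
  have "\<exists>s. \<forall>n. P n (s n) \<and> Q n (s n) (s (Suc n))"
  proof (rule dependent_nat_choice)
    show "\<exists>p. P 0 p"
      unfolding P_def using automorphism_id by (intro exI[of _ "({}, id)"]) auto
  next
    fix p n assume "P n p"
    then obtain F g where p: "p = (F, g)" and F: "finite F" "F \<subseteq> univ S" "g ` F \<subseteq> A"
      and g: "automorphism S g"
      unfolding P_def by (auto split: prod.splits)
    have en: "e n \<in> univ S" and dn: "d n \<in> A"
      using e d by auto
    obtain g' where g': "automorphism S g'" "\<And>z. z \<in> F \<Longrightarrow> g' z = g z" "g' (e n) \<in> A"
      using extend_partial_automorphism[OF g F A meets en] by blast
    \<comment> \<open>The back direction costs nothing: \<open>g'\<close> is onto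
      \<open>univ S\<close>, so \<open>d n\<close> has a preimage \<open>w\<close>, and since its
      value \<open>d n\<close> is in \<open>A\<close> it may join the domain.\<close>
    have "d n \<in> g' ` univ S"
      using dn A g'(1) unfolding isomorphism_def by auto
    then obtain w where w: "w \<in> univ S" "d n = g' w"
      by auto
    show "\<exists>q. P (Suc n) q \<and> Q n p q"
      unfolding P_def Q_def p using F g' en dn w
      by (intro exI[of _ "(insert w (insert (e n) F), g')"]) auto
  qed
  then obtain s where s: "\<And>n. P n (s n)" "\<And>n. Q n (s n) (s (Suc n))"
    by blast
  define F where "F n = fst (s n)" for n
  define g where "g n = snd (s n)" for n
  have g: "automorphism S (g n)" and gF: "g n ` F n \<subseteq> A" for n
    using s(1)[of n] unfolding P_def F_def g_def by (auto split: prod.splits)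
  have step: "F n \<subseteq> F (Suc n)" "\<forall>z\<in>F n. g (Suc n) z = g n z" "e n \<in> F (Suc n)"
    "d n \<in> g (Suc n) ` F (Suc n)" for n
    using s(2)[of n] unfolding Q_def F_def g_def by (auto split: prod.splits)
  have agree: "F m \<subseteq> F n \<and> (\<forall>z\<in>F m. g n z = g m z)" if "m \<le> n" for m n
    using that
  proof (induction rule: dec_induct)
    case (step n)
    then show ?case
      using \<open>F n \<subseteq> F (Suc n)\<close> \<open>\<forall>z\<in>F n. g (Suc n) z = g n z\<close> by auto
  qed auto
  have covered: "\<exists>n. x \<in> F n" if "x \<in> univ S" for x
    using that step(3) e by (metis rangeE)
  \<comment> \<open>The limit map. By \<open>agree\<close>, any stage whose domain contains
    \<open>x\<close> gives the same value as the first one.\<close>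
  define f where "f x = g (LEAST n. x \<in> F n) x" for x
  have f: "f x = g n x" if "x \<in> F n" for x n
  proof -
    have "x \<in> F (LEAST n. x \<in> F n)" "(LEAST n. x \<in> F n) \<le> n"
      using that by (auto intro: LeastI Least_le)
    then show ?thesis
      unfolding f_def using agree by metis
  qed
  \<comment> \<open>A finite set lies in the domain of a single stage, so injectivity and
    preservation of each relation are inherited from one automorphism \<open>g n\<close>.\<close>
  have common: "\<exists>n. Y \<subseteq> F n" if "finite Y" "Y \<subseteq> univ S" for Y
    using that
  proof (induction rule: finite_induct)
    case (insert y Y)
    then obtain m n where "Y \<subseteq> F n" "y \<in> F m"
      using covered by blast
    then have "insert y Y \<subseteq> F (max m n)"
      using agree[of n "max m n"] agree[of m "max m n"] by auto
    then show ?case ..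
  qed auto
  have "embedding S S f"
    unfolding embedding_def
  proof (intro conjI allI ballI)
    show "inj_on f (univ S)"
    proof (rule inj_onI)
      fix x y assume xy: "x \<in> univ S" "y \<in> univ S" "f x = f y"
      then obtain n where "{x, y} \<subseteq> F n"
        using common[of "{x, y}"] by auto
      then show "x = y"
        using xy f g[of n] unfolding isomorphism_def embedding_def
        by (metis inj_onD insert_subset)
    qed
    show "f ` univ S \<subseteq> univ S"
      using covered f gF A by (metis (no_types, opaque_lifting) image_subset_iff subsetD)
    fix i xs assume xs: "xs \<in> lists (univ S)"
    then obtain n where n: "set xs \<subseteq> F n"
      using common[of "set xs"] by (auto simp: in_lists_conv_set)
    then have "map f xs = map (g n) xs"
      using f by (auto simp: subset_iff)
    then show "xs \<in> rel S i \<longleftrightarrow> map f xs \<in> rel S i"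
      using g[of n] xs unfolding isomorphism_def embedding_def by metis
  qed
  moreover have "f ` univ S = A"
  proof
    show "f ` univ S \<subseteq> A"
      using covered f gF by (metis (no_types, opaque_lifting) image_subset_iff)
    show "A \<subseteq> f ` univ S"
    proof
      fix y assume "y \<in> A"
      then obtain n where "y = d n"
        using d by auto
      then obtain w where w: "w \<in> F (Suc n)" "y = g (Suc n) w"
        using step(4)[of n] by auto
      moreover have "w \<in> univ S"
        using w(1) s(1)[of "Suc n"] unfolding P_def F_def by (auto split: prod.splits)
      ultimately show "y \<in> f ` univ S"
        using f[of w "Suc n"] by force
    qed
  qed
  ultimately show ?thesis
    unfolding copies_def by blast
qed

lemma large_copiesI:
  assumes "countable (univ S)" "A \<subseteq> univ S" "\<And>Orb. Orb \<in> orbits S \<Longrightarrow> infinite (A \<inter> Orb)"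
  shows "A \<in> large_copies S"
proof -
  have "orb S F x \<inter> A \<noteq> {}" if "finite F" "F \<subseteq> A" "x \<in> univ S - F" for F x
  proof -
    have "orb S F x \<in> orbits S"
      using that assms(2) unfolding orbits_def by blast
    then show ?thesis
      using assms(3)[of "orb S F x"] by (metis Int_commute finite.emptyI)
  qed
  then show ?thesis
    using copiesI[OF assms(1,2)] assms(3) unfolding large_copies_def by blast
qed

section \<open>Distinct representatives of infinite sets\<close>

text \<open>Choose recursively: finitely many earlier points cannot exhaust an infinite set.\<close>

lemma injective_choice_nat:
  fixes T :: "nat \<Rightarrow> 'a set"
  assumes "\<And>n. infinite (T n)"
  obtains x where "inj x" "\<And>n. x n \<in> T n"
proof -
  have "\<exists>x. \<forall>n. x n \<in> T n \<and> x n \<notin> x ` {..<n}"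
  proof (rule dependent_wellorder_choice)
    show "\<exists>r. r \<in> T n \<and> r \<notin> x ` {..<n}" for n and x :: "nat \<Rightarrow> 'a"
    proof -
      have "T n - x ` {..<n} \<noteq> {}"
        using assms by (intro infinite_imp_nonempty Diff_infinite_finite) auto
      then show ?thesis by blast
    qed
  qed auto
  then obtain x where x: "\<And>n. x n \<in> T n \<and> x n \<notin> x ` {..<n}"
    by blast
  have "x m \<noteq> x n" if "m < n" for m n
  proof -
    have "x m \<in> x ` {..<n}"
      using that by blast
    then show ?thesis
      using x[of n] by auto
  qed
  then have "inj x"
    by (metis injI linorder_neqE_nat)
  with x show thesis
    using that by blast
qed

lemma injective_choice:
  fixes T :: "'k::countable \<Rightarrow> 'a set"
  assumes "\<And>k. infinite (T k)"
  obtains x where "inj x" "\<And>k. x k \<in> T k"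
proof -
  obtain x where x: "inj x" "\<And>n. x n \<in> T (from_nat n)"
    using injective_choice_nat[of "\<lambda>n. T (from_nat n)"] assms by blast
  show thesis
  proof (rule that)
    show "inj (x \<circ> to_nat)"
      using x(1) by (intro inj_compose) auto
    show "(x \<circ> to_nat) k \<in> T k" for k
      using x(2)[of "to_nat k"] by simp
  qed
qed

text \<open>Choose distinct points \<open>x (i, j, n)\<close> of \<open>T i\<close>. The middle
  index names the block that receives the point, and \<open>n\<close> supplies infinitely many
  points for each pair of \<open>i\<close> and \<open>j\<close>.\<close>

lemma infinite_partition:
  fixes T :: "nat \<Rightarrow> 'a set"
  assumes inf: "\<And>i. infinite (T i)" and sub: "\<And>i. T i \<subseteq> U"
  obtains B :: "nat \<Rightarrow> 'a set" where "disjoint_family B" "(\<Union>j. B j) = U" "\<And>i j. infinite (B j \<inter> T i)"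
proof -
  obtain x :: "nat \<times> nat \<times> nat \<Rightarrow> 'a" where x: "inj x" "\<And>k. x k \<in> T (fst k)"
    using injective_choice[of "\<lambda>k. T (fst k)"] inf by blast
  \<comment> \<open>Points of \<open>U\<close> that were not chosen go to block 0, so that the
    blocks cover \<open>U\<close>.\<close>
  define B where "B j = {u \<in> U. j = (if u \<in> range x then fst (snd (inv x u)) else 0)}" for j
  show thesis
  proof (rule that)
    show "disjoint_family B"
      unfolding disjoint_family_on_def B_def by auto
    show "(\<Union>j. B j) = U"
      unfolding B_def by auto
    fix i j
    have "range (\<lambda>n. x (i, j, n)) \<subseteq> B j \<inter> T i"
      using x sub unfolding B_def by fastforce
    moreover have "inj (\<lambda>n. x (i, j, n))"
      using x(1) by (auto simp: inj_def)
    ultimately show "infinite (B j \<inter> T i)"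
      by (meson infinite_super range_inj_infinite)
  qed
qed

text \<open>Subsets of \<open>nat\<close> are viewed as branches of the binary tree. Two distinct
  branches share only finitely many nodes, and each node contributes only finitely many points to a
  branch.\<close>

lemma almost_disjoint_family:
  fixes T :: "nat \<Rightarrow> 'a set"
  assumes inf: "\<And>i. infinite (T i)" and sub: "\<And>i. T i \<subseteq> U"
  obtains A :: "nat set \<Rightarrow> 'a set"
  where "\<And>\<alpha>. A \<alpha> \<subseteq> U" "\<And>\<alpha> i. infinite (A \<alpha> \<inter> T i)" "\<And>\<alpha> \<beta>. \<alpha> \<noteq> \<beta> \<Longrightarrow> finite (A \<alpha> \<inter> A \<beta>)"
proof -
  obtain x :: "bool list \<times> nat \<Rightarrow> 'a" where x: "inj x" "\<And>k. x k \<in> T (snd k)"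
    using injective_choice[of "\<lambda>k. T (snd k)"] inf by blast
  \<comment> \<open>The initial segment of length \<open>n\<close> of the characteristic function of
    \<open>\<alpha>\<close>.\<close>
  define node where "node \<alpha> n = map (\<lambda>k. k \<in> \<alpha>) [0..<n]" for \<alpha> :: "nat set" and n
  have node_length: "length (node \<alpha> n) = n" for \<alpha> n
    by (simp add: node_def)
  \<comment> \<open>The bound \<open>i \<le> n\<close> keeps the contribution of each node finite,
    yet every \<open>T i\<close> receives a point at all levels from \<open>i\<close> on.\<close>
  define A where "A \<alpha> = {x (node \<alpha> n, i) | n i. i \<le> n}" for \<alpha>
  show thesis
  proof (rule that)
    show "A \<alpha> \<subseteq> U" for \<alpha>
      unfolding A_def using x(2) sub by fastforce
    show "infinite (A \<alpha> \<inter> T i)" for \<alpha> i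
    proof -
      have "(\<lambda>n. x (node \<alpha> n, i)) ` {i..} \<subseteq> A \<alpha> \<inter> T i"
        unfolding A_def using x(2)[of "(node \<alpha> _, i)"] by auto
      moreover have "inj (\<lambda>n. x (node \<alpha> n, i))"
        using x(1) node_length by (metis (mono_tags, lifting) injD injI prod.inject)
      then have "infinite ((\<lambda>n. x (node \<alpha> n, i)) ` {i..})"
        by (meson finite_imageD infinite_Ici inj_on_subset subset_UNIV)
      ultimately show ?thesis
        using infinite_super by blast
    qed
    show "finite (A \<alpha> \<inter> A \<beta>)" if neq: "\<alpha> \<noteq> \<beta>" for \<alpha> \<beta>
    proof -
      obtain k where k: "(k \<in> \<alpha>) \<noteq> (k \<in> \<beta>)"
        using neq by blast
      have "n \<le> k" if "node \<alpha> n = node \<beta> n" for n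
      proof (rule ccontr)
        assume "\<not> n \<le> k"
        then have "node \<alpha> n ! k = (k \<in> \<alpha>)" "node \<beta> n ! k = (k \<in> \<beta>)"
          by (simp_all add: node_def)
        then show False
          using that k by simp
      qed
      \<comment> \<open>Injectivity of \<open>x\<close> forces a shared point to come from the same
        node on both branches; the levels then agree because \<open>node\<close> determines its
        length.\<close>
      moreover have "\<exists>n i. i \<le> n \<and> node \<alpha> n = node \<beta> n \<and> u = x (node \<alpha> n, i)"
        if u_in: "u \<in> A \<alpha> \<inter> A \<beta>" for u
      proof -
        obtain m n i j where u: "u = x (node \<alpha> n, i)" "i \<le> n" "u = x (node \<beta> m, j)"
          using u_in unfolding A_def by blast
        then have "node \<alpha> n = node \<beta> m"
          using x(1) by (auto dest: injD)
        then have "n = m"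
          using node_length by metis
        then show ?thesis
          using u \<open>node \<alpha> n = node \<beta> m\<close> by blast
      qed
      ultimately have "A \<alpha> \<inter> A \<beta> \<subseteq> (\<lambda>(n, i). x (node \<alpha> n, i)) ` ({..k} \<times> {..k})"
        by (smt (verit) SigmaI atMost_iff case_prod_conv image_eqI le_trans subsetI)
      then show ?thesis
        by (rule finite_subset) simp
    qed
  qed
qed

section \<open>Antichains\<close>

text \<open>Zorn's lemma applied to the antichains containing \<open>Q\<close>. Unions of chains
  stay antichains because any two elements of the union lie in one member of the chain.\<close>

lemma antichain_in_extend_maximal:
  assumes "antichain_in P Q"
  obtains M where "maximal_antichain_in P M" "Q \<subseteq> M"
proof -
  define K where "K = {M. antichain_in P M \<and> Q \<subseteq> M}"
  have "\<exists>M\<in>K. \<forall>N\<in>K. M \<subseteq> N \<longrightarrow> N = M"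
  proof (rule subset_Zorn_nonempty)
    show "K \<noteq> {}"
      using assms unfolding K_def by blast
    fix C assume C: "C \<noteq> {}" "subset.chain K C"
    then have CK: "C \<subseteq> K" and total: "\<And>M N. M \<in> C \<Longrightarrow> N \<in> C \<Longrightarrow> M \<subseteq> N \<or> N \<subseteq> M"
      by (auto simp: subset_chain_def)
    have "pairwise (\<lambda>p q. \<not> compatible_in P p q) (\<Union>C)"
    proof (rule pairwiseI)
      fix p q assume "p \<in> \<Union>C" "q \<in> \<Union>C" "p \<noteq> q"
      then obtain M where "M \<in> C" "p \<in> M" "q \<in> M"
        using total by (metis UnionE subsetD)
      then show "\<not> compatible_in P p q"
        using CK \<open>p \<noteq> q\<close> unfolding K_def antichain_in_def pairwise_def by blast
    qed
    then show "\<Union>C \<in> K"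
      using CK C(1) unfolding K_def antichain_in_def by blast
  qed
  then obtain M where M: "antichain_in P M" "Q \<subseteq> M"
    and max: "\<And>N. antichain_in P N \<Longrightarrow> M \<subseteq> N \<Longrightarrow> N = M"
    unfolding K_def by auto
  have "\<exists>q\<in>M. compatible_in P p q" if p: "p \<in> P" for p
  proof (rule ccontr)
    assume none: "\<not> (\<exists>q\<in>M. compatible_in P p q)"
    \<comment> \<open>An element incompatible with all of \<open>M\<close> could be added, so it is
      in \<open>M\<close> by maximality; but it is compatible with itself.\<close>
    then have "antichain_in P (insert p M)"
      using M(1) p unfolding antichain_in_def pairwise_insert
      by (auto simp: compatible_in_def)
    then have "p \<in> M"
      using max by blast
    then show False
      using none p unfolding compatible_in_def by blast
  qed
  then show thesis
    using that M unfolding maximal_antichain_in_def by blast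
qed

text \<open>A common lower bound in \<open>P\<close> would be an infinite subset of a finite
  intersection.\<close>

lemma almost_disjoint_antichain_in:
  assumes "Q \<subseteq> P" "\<And>A. A \<in> P \<Longrightarrow> infinite A" "pairwise (\<lambda>A B. finite (A \<inter> B)) Q"
  shows "antichain_in P Q"
  unfolding antichain_in_def
proof
  show "pairwise (\<lambda>A B. \<not> compatible_in P A B) Q"
    using assms(3)
  proof (rule pairwise_mono)
    show "\<not> compatible_in P A B" if "finite (A \<inter> B)" for A B
      using that assms(2) unfolding compatible_in_def by (meson finite_subset le_inf_iff)
  qed simp
qed (rule assms(1))

text \<open>This controls the size of the antichain supplied by Zorn's lemma: \<open>Q\<close>
  bounds it from below and the power set of a countable set from above, so Schroeder-Bernstein
  applies.\<close>

lemma has_size_continuum_superset: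
  fixes U :: "'a set"
  assumes "has_size_continuum Q" "Q \<subseteq> M" "M \<subseteq> Pow U" "countable U"
  shows "has_size_continuum M"
proof -
  obtain f :: "'a \<Rightarrow> nat" where "inj_on f U"
    using assms(4) unfolding countable_def by blast
  then have "inj_on ((`) f) M"
    using assms(3) by (meson inj_on_image_Pow inj_on_subset)
  then have "M \<lesssim> (UNIV :: nat set set)"
    unfolding lepoll_def by blast
  moreover have "(UNIV :: nat set set) \<lesssim> M"
    using assms(1,2) unfolding has_size_continuum_def
    by (metis eqpoll_imp_lepoll eqpoll_sym lepoll_trans subset_imp_lepoll)
  ultimately show ?thesis
    unfolding has_size_continuum_def by (rule lepoll_antisym)
qed

section \<open>Applying the combinatorial lemmas to an enumeration of the orbits\<close>

theorem theorem1p1: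
  fixes ar :: "'i \<Rightarrow> nat" and X :: "('a, 'i) rel_struct"
  assumes "is_struct ar X"
    and "univ X \<noteq> {}"
    and "countable (univ X)"
    and "ultrahomogeneous X"
    and "strong_amalgamation (age ar X)"
  shows
    "(\<exists>B :: nat \<Rightarrow> 'a set.
        (\<forall>j. B j \<in> large_copies X) \<and> disjoint_family B \<and> (\<Union>j. B j) = univ X)
     \<and> (\<exists>\<A>. \<A> \<subseteq> large_copies X \<and> has_size_continuum \<A> \<and>
          pairwise (\<lambda>A B. finite (A \<inter> B)) \<A>)
     \<and> (\<exists>\<A>. antichain_in (copies X) \<A> \<and> has_size_continuum \<A>)
     \<and> (\<exists>\<A>. maximal_antichain_in (copies X) \<A> \<and> has_size_continuum \<A>)"
proof -
  note infinite_orb = infinite_orbits[OF assms(1,4,5)]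
  have orb_sub: "Orb \<subseteq> univ X" if "Orb \<in> orbits X" for Orb
    using that unfolding orbits_def orb_def by auto
  have nonempty: "orbits X \<noteq> {}"
    using assms(2) unfolding orbits_def by blast
  \<comment> \<open>\<open>T\<close> may repeat orbits, which is harmless: only its range and the
    infinity of each \<open>T i\<close> matter.\<close>
  define T where "T = from_nat_into (orbits X)"
  have T: "range T = orbits X"
    unfolding T_def by (rule range_from_nat_into[OF nonempty countable_orbits[OF assms(3)]])
  then have "T i \<in> orbits X" for i
    by blast
  then have infT: "\<And>i. infinite (T i)" and subT: "\<And>i. T i \<subseteq> univ X"
    using infinite_orb orb_sub by blast+
  have large: "A \<in> large_copies X" if "A \<subseteq> univ X" "\<And>i. infinite (A \<inter> T i)" for A
    using large_copiesI[OF assms(3) that(1)] that(2) T by (metis rangeE)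

  obtain B :: "nat \<Rightarrow> 'a set" where B: "disjoint_family B" "(\<Union>j. B j) = univ X" "\<And>i j. infinite (B j \<inter> T i)"
    using infinite_partition[of T, OF infT subT] by blast
  then have "B j \<in> large_copies X" for j
    by (intro large) auto
  with B have a: "\<exists>B :: nat \<Rightarrow> 'a set.
      (\<forall>j. B j \<in> large_copies X) \<and> disjoint_family B \<and> (\<Union>j. B j) = univ X"
    by blast

  obtain A :: "nat set \<Rightarrow> 'a set" where A: "\<And>\<alpha>. A \<alpha> \<subseteq> univ X" "\<And>\<alpha> i. infinite (A \<alpha> \<inter> T i)"
    "\<And>\<alpha> \<beta>. \<alpha> \<noteq> \<beta> \<Longrightarrow> finite (A \<alpha> \<inter> A \<beta>)"
    using almost_disjoint_family[of T, OF infT subT] by blast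
  have A_large: "range A \<subseteq> large_copies X"
    using large A by blast
  \<comment> \<open>If \<open>A \<alpha> = A \<beta>\<close> for distinct indices, then
    \<open>A \<alpha>\<close> would be its own finite intersection with \<open>A \<beta>\<close>,
    although it meets each \<open>T i\<close> in an infinite set.\<close>
  have "inj A"
    using A(2,3) by (metis finite_Int inf.idem injI)
  then have size: "has_size_continuum (range A)"
    unfolding has_size_continuum_def by (rule inj_on_image_eqpoll_self)
  have ad: "pairwise (\<lambda>A B. finite (A \<inter> B)) (range A)"
    by (intro pairwise_imageI A(3))

  \<comment> \<open>The universe contains an infinite orbit, and copies are injective images of it;
    this makes almost disjoint copies incompatible.\<close>
  have "infinite (univ X)"
    using infT subT by (metis finite_subset)
  then have copies_infinite: "infinite C" if "C \<in> copies X" for C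
    using that unfolding copies_def embedding_def by (auto dest: finite_imageD)
  have copies_sub: "copies X \<subseteq> Pow (univ X)"
    unfolding copies_def embedding_def by auto
  have antichain: "antichain_in (copies X) (range A)"
    using A_large copies_infinite ad
    by (intro almost_disjoint_antichain_in) (auto simp: large_copies_def)
  then obtain M where M: "maximal_antichain_in (copies X) M" "range A \<subseteq> M"
    by (rule antichain_in_extend_maximal)
  then have "M \<subseteq> Pow (univ X)"
    using copies_sub unfolding maximal_antichain_in_def antichain_in_def by blast
  with M have "has_size_continuum M"
    using has_size_continuum_superset[OF size _ _ assms(3)] by blast
  with a A_large size ad antichain M(1) show ?thesis
    by blast
qed

end
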